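(* For the mechanical system described in the context, released from its initial position, an equilibrium is reached after a finite time.
   Context: Data: a matrix $c_{ij}$ of arbitrary (integer or real, positive or negative) numbers, and two vectors $a_i\ge 0$, $b_j\ge 0$, where $i$ runs from $1$ to $m$ and $j$ from $1$ to $n$, with $\sum_{i=1}^m a_i=\sum_{j=1}^n b_j$. Mechanical system: in physical space with axes $x,y,z$ ($z$ vertical), to every $i$ is associated a rod $A_i$ (a row), which remains parallel to the $y$ axis and can only move vertically, in a fixed vertical plane $x=$ Const.; the variable height of its lower face is $\alpha_i$, and it has weight $a_i$, so it is subjected to a force $a_i$ towards negative $z$. To every $j$ is associated a rod $B_j$ (a column), which remains parallel to the $x$ axis and can only move vertically, in a fixed vertical plane $y=$ Const.; the variable height of its upper face is $\beta_j$, and it has negative weight $-b_j$ (buoyancy $b_j$), so it is subjected to a force $b_j$ towards positive $z$. Small vertical studs of height $c_{ij}$ and negligible weight are placed on the columns so that each enforces a minimal distance between row $A_i$ and column $B_j$: $\alpha_i-\beta_j\ge c_{ij}$. Row $A_i$ and column $B_j$ are in contact (through the stud $c_{ij}$) when $\alpha_i-\beta_j=c_{ij}$. Initial position and release: initially all rods are maintained at a fixed position by two additional fixed rods acting as stops, with the rows well above the columns, so that there is no contact between the rows and the studs; for instance $\beta_j=0$ for all $j$ and $\alpha_i=c_{\rm sup}$ for all $i$, where $c_{\rm sup}$ is a constant with $c_{\rm sup}>\max_{i,j}c_{ij}$. Then the rods are released by removing the stops, and the system evolves: rows go down, columns go up, contacts are made with the studs, and aggregates of rows and columns are progressively formed and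 are modified as new contacts are made. Law of motion: an aggregate is a subset $S$ of rows and columns which are in contact (they form a connected set in space) and move with the same velocity; it is also assumed to be a maximal connected set: no other row or column touches it. The downward force acting on it is its total weight $M(S)=\sum_{A_i\in S}a_i-\sum_{B_j\in S}b_j$. The system is imagined to be immersed in a viscous fluid, so that velocity rather than acceleration is proportional to force; specifically, the aggregate moves with velocity $dz/dt=-M(S)$. In particular an aggregate remains motionless if the force applied to it vanishes. The system is in equilibrium when all aggregates are motionless. *)

theory Defs
  imports "HOL-Analysis.Analysis"
begin

text \<open>
  A rod is an element of \<open>'r + 'c\<close>: \<open>Inl i\<close> is the row \<open>A\<^sub>i\<close>, \<open>Inr j\<close> is the column \<open>B\<^sub>j\<close>.
  \<open>\<alpha> i t\<close> is the height of the lower face of row \<open>i\<close> at time \<open>t\<close>, and \<open>\<beta> j t\<close> that of the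
  upper face of column \<open>j\<close>.
\<close>

definition height :: "('r \<Rightarrow> real \<Rightarrow> real) \<Rightarrow> ('c \<Rightarrow> real \<Rightarrow> real) \<Rightarrow> 'r + 'c \<Rightarrow> real \<Rightarrow> real" where
  "height \<alpha> \<beta> = case_sum \<alpha> \<beta>"

definition contacts ::
  "('r \<Rightarrow> 'c \<Rightarrow> real) \<Rightarrow> ('r \<Rightarrow> real \<Rightarrow> real) \<Rightarrow> ('c \<Rightarrow> real \<Rightarrow> real) \<Rightarrow> real \<Rightarrow> ('r + 'c) rel" where
  "contacts c \<alpha> \<beta> t =
     {(Inl i, Inr j) | i j. \<alpha> i t - \<beta> j t = c i j} \<union>
     {(Inr j, Inl i) | i j. \<alpha> i t - \<beta> j t = c i j}"

definition connected_rods :: "('r + 'c) rel \<Rightarrow> ('r + 'c) set \<Rightarrow> bool" where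
  "connected_rods G S \<longleftrightarrow> S \<noteq> {} \<and> (\<forall>p\<in>S. \<forall>q\<in>S. (p, q) \<in> (G \<inter> S \<times> S)\<^sup>*)"

definition moves_with ::
  "('r \<Rightarrow> real \<Rightarrow> real) \<Rightarrow> ('c \<Rightarrow> real \<Rightarrow> real) \<Rightarrow> real \<Rightarrow> ('r + 'c) set \<Rightarrow> real \<Rightarrow> bool" where
  "moves_with \<alpha> \<beta> t S v \<longleftrightarrow> (\<forall>p\<in>S. (height \<alpha> \<beta> p has_real_derivative v) (at t))"

definition aggregate ::
  "('r \<Rightarrow> 'c \<Rightarrow> real) \<Rightarrow> ('r \<Rightarrow> real \<Rightarrow> real) \<Rightarrow> ('c \<Rightarrow> real \<Rightarrow> real) \<Rightarrow> real \<Rightarrow> ('r + 'c) set \<Rightarrow> bool" where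
  "aggregate c \<alpha> \<beta> t S \<longleftrightarrow>
     connected_rods (contacts c \<alpha> \<beta> t) S \<and>
     (\<exists>v. moves_with \<alpha> \<beta> t S v) \<and>
     (\<forall>p\<in>S. \<forall>q. q \<notin> S \<longrightarrow> (p, q) \<notin> contacts c \<alpha> \<beta> t)"

definition total_weight ::
  "('r::finite \<Rightarrow> real) \<Rightarrow> ('c::finite \<Rightarrow> real) \<Rightarrow> ('r + 'c) set \<Rightarrow> real" where
  "total_weight a b S = (\<Sum>i | Inl i \<in> S. a i) - (\<Sum>j | Inr j \<in> S. b j)"

text \<open>
  The first conjunct matters: at an instant where rods collide or separate, a rod may have no
  velocity, or may touch a rod whose velocity differs from its own, and then it belongs to no
  aggregate.
\<close>

definition every_rod_in_aggregate ::
  "('r \<Rightarrow> 'c \<Rightarrow> real) \<Rightarrow> ('r \<Rightarrow> real \<Rightarrow> real) \<Rightarrow> ('c \<Rightarrow> real \<Rightarrow> real) \<Rightarrow> real \<Rightarrow> bool" where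
  "every_rod_in_aggregate c \<alpha> \<beta> t \<longleftrightarrow> (\<forall>p. \<exists>S. aggregate c \<alpha> \<beta> t S \<and> p \<in> S)"

definition law_of_motion ::
  "('r::finite \<Rightarrow> 'c::finite \<Rightarrow> real) \<Rightarrow> ('r \<Rightarrow> real) \<Rightarrow> ('c \<Rightarrow> real) \<Rightarrow>
   ('r \<Rightarrow> real \<Rightarrow> real) \<Rightarrow> ('c \<Rightarrow> real \<Rightarrow> real) \<Rightarrow> real \<Rightarrow> bool" where
  "law_of_motion c a b \<alpha> \<beta> t \<longleftrightarrow>
     every_rod_in_aggregate c \<alpha> \<beta> t \<and>
     (\<forall>S. aggregate c \<alpha> \<beta> t S \<longrightarrow> moves_with \<alpha> \<beta> t S (- total_weight a b S))"

definition equilibrium ::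
  "('r \<Rightarrow> 'c \<Rightarrow> real) \<Rightarrow> ('r \<Rightarrow> real \<Rightarrow> real) \<Rightarrow> ('c \<Rightarrow> real \<Rightarrow> real) \<Rightarrow> real \<Rightarrow> bool" where
  "equilibrium c \<alpha> \<beta> t \<longleftrightarrow>
     every_rod_in_aggregate c \<alpha> \<beta> t \<and>
     (\<forall>S. aggregate c \<alpha> \<beta> t S \<longrightarrow> moves_with \<alpha> \<beta> t S 0)"

text \<open>
  The system is released at time 0. After every instant \<open>t\<close> the law of motion holds for some
  time; it may fail at \<open>t\<close> itself, where contacts may be made or broken and velocities may jump.
  Nothing is prescribed about how aggregates are rearranged at such an instant, beyond continuity
  of the heights, the minimal distances enforced by the studs, and the law of motion afterwards.
  The instants of rearrangement may accumulate from the left.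
\<close>

definition motion ::
  "('r::finite \<Rightarrow> 'c::finite \<Rightarrow> real) \<Rightarrow> ('r \<Rightarrow> real) \<Rightarrow> ('c \<Rightarrow> real) \<Rightarrow>
   ('r \<Rightarrow> real \<Rightarrow> real) \<Rightarrow> ('c \<Rightarrow> real \<Rightarrow> real) \<Rightarrow> bool" where
  "motion c a b \<alpha> \<beta> \<longleftrightarrow>
     (\<forall>p. continuous_on {0..} (height \<alpha> \<beta> p)) \<and>
     (\<forall>t\<ge>0. \<forall>i j. \<alpha> i t - \<beta> j t \<ge> c i j) \<and>
     (\<forall>t\<ge>0. \<forall>\<^sub>F s in at_right t. law_of_motion c a b \<alpha> \<beta> s)"

definition initial_position ::
  "('r \<Rightarrow> 'c \<Rightarrow> real) \<Rightarrow> ('r \<Rightarrow> real \<Rightarrow> real) \<Rightarrow> ('c \<Rightarrow> real \<Rightarrow> real) \<Rightarrow> bool" where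
  "initial_position c \<alpha> \<beta> \<longleftrightarrow> (\<forall>i j. \<alpha> i 0 - \<beta> j 0 > c i j)"

end

theory Submission imports Defs begin

text \<open>
  The system dissipates its potential energy
  \<open>U = (\<Sum>i. a i * \<alpha> i) - (\<Sum>j. b j * \<beta> j)\<close>. At an instant at which the law of motion holds,
  every rod of an aggregate \<open>S\<close> has velocity \<open>- M(S)\<close>, so that \<open>U\<close> has derivative
  \<open>- (\<Sum>S. M(S)\<^sup>2)\<close>, the sum being over the aggregates (\<open>energy_dissipation\<close>). There are finitely
  many sets of rods, hence the rate of dissipation is either 0, with all rods at rest, or at
  least a positive constant \<open>\<epsilon>\<close> (\<open>dissipation_ge_weight_gap\<close>). As the total weight equals the total
  buoyancy, the studs bound \<open>U\<close> from below (\<open>energy_bounded_below\<close>).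

  This alone bounds only the total time spent in motion; it does not exclude that the system
  rests for a while and then departs again, infinitely often. Indeed an aggregate of weight 0 may
  hang together for some time and then break up. The second ingredient is that
  \<open>U\<close> takes finitely many values at instants of rest (\<open>finite_energy_at_rest\<close>): then every
  aggregate has weight 0, so its energy is unchanged when it is translated as a whole,
  and the relative heights inside it are dictated by its studs; \<open>U\<close> is a function of the contact
  graph.

  If the instants of rest were bounded, \<open>U\<close> would eventually decrease at rate \<open>\<epsilon>\<close> for ever,
  against the lower bound. Thus they are unbounded. The nonincreasing function \<open>U\<close> attains its
  least value among them at some instant, and from then on it is squeezed to a constant. No
  energy is dissipated any more, so all velocities vanish and the rods stay where they are.
\<close>

section \<open>Functions that decrease to the right of every instant\<close>

text \<open>
  The instants at which the derivative is unknown may accumulate from the left, so the half-line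
  cannot be cut into a sequence of intervals. A supremum argument replaces the cutting: by
  continuity the last time up to \<open>x\<close> at which \<open>f\<close> is at most \<open>f T\<close> exists, and
  the local decrease would push it further if it came before \<open>x\<close>.
\<close>

lemma nonincreasing_if_decreasing_at_right:
  fixes f :: "real \<Rightarrow> real"
  assumes cont: "continuous_on {T..} f"
    and right: "\<And>t. t \<ge> T \<Longrightarrow> \<forall>\<^sub>F s in at_right t. \<exists>y. (f has_real_derivative y) (at s) \<and> y \<le> 0"
    and "T \<le> x"
  shows "f x \<le> f T"
proof -
  define C where "C = {T..x} \<inter> f -` {..f T}"
  have "continuous_on {T..x} f"
    using cont by (rule continuous_on_subset) auto
  then have "closed C"
    unfolding C_def by (rule continuous_closed_preimage) auto
  moreover have "T \<in> C" and bdd: "bdd_above C"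
    using \<open>T \<le> x\<close> by (auto simp: C_def intro: bdd_above_mono[OF bdd_above_Icc])
  ultimately have m: "Sup C \<in> C"
    by (intro closed_contains_Sup) auto
  have "Sup C = x"
  proof (rule ccontr)
    define m where "m = Sup C"
    assume "Sup C \<noteq> x"
    with m have "T \<le> m" "m < x" "f m \<le> f T"
      by (auto simp: C_def m_def)
    from right[OF \<open>T \<le> m\<close>] obtain u where "u > m"
      and u: "\<And>s. m < s \<Longrightarrow> s < u \<Longrightarrow> \<exists>y. (f has_real_derivative y) (at s) \<and> y \<le> 0"
      unfolding eventually_at_right_field by blast
    define s where "s = min x u"
    have s: "m < s" "s \<le> x" "s \<le> u"
      using \<open>m < x\<close> \<open>m < u\<close> by (auto simp: s_def)
    have "f s \<le> f m"
    proof (rule DERIV_nonpos_imp_decreasing_open[of m s f])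
      show "continuous_on {m..s} f"
        using cont by (rule continuous_on_subset) (use \<open>T \<le> m\<close> in auto)
    next
      show "m \<le> s" using s by simp
    next
      fix r assume "m < r" "r < s"
      then show "\<exists>y. (f has_real_derivative y) (at r) \<and> y \<le> 0"
        using s by (intro u) auto
    qed
    then have "s \<in> C"
      using s \<open>T \<le> m\<close> \<open>f m \<le> f T\<close> by (auto simp: C_def)
    then have "s \<le> m"
      unfolding m_def using bdd by (rule cSup_upper)
    with s show False by simp
  qed
  with m show ?thesis by (simp add: C_def)
qed

lemma derivative_zero_if_constant:
  fixes f :: "real \<Rightarrow> real"
  assumes const: "\<And>t. t \<ge> T \<Longrightarrow> f t = f T" and "t > T"
  shows "(f has_real_derivative 0) (at t)"
proof (rule has_field_derivative_transform_within_open)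
  show "((\<lambda>_. f T) has_real_derivative 0) (at t)" by simp
  show "t \<in> {T<..}" using \<open>t > T\<close> by simp
  show "f T = f x" if "x \<in> {T<..}" for x
    using const[of x] that by simp
qed simp

section \<open>Aggregates\<close>

text \<open>By maximality of \<open>S'\<close>, a path of contacts that starts in \<open>S'\<close> cannot leave it.\<close>

lemma aggregate_subset:
  assumes S: "aggregate c \<alpha> \<beta> t S" and S': "aggregate c \<alpha> \<beta> t S'"
    and p: "p \<in> S" "p \<in> S'"
  shows "S \<subseteq> S'"
proof
  fix q assume "q \<in> S"
  then have "(p, q) \<in> (contacts c \<alpha> \<beta> t \<inter> S \<times> S)\<^sup>*"
    using S p by (auto simp: aggregate_def connected_rods_def)
  then show "q \<in> S'"
    by induction (use S' p in \<open>auto simp: aggregate_def\<close>)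
qed

lemma aggregates_disjoint:
  assumes "aggregate c \<alpha> \<beta> t S" "aggregate c \<alpha> \<beta> t S'" "S \<noteq> S'"
  shows "S \<inter> S' = {}"
  using aggregate_subset[of c \<alpha> \<beta> t S S'] aggregate_subset[of c \<alpha> \<beta> t S' S] assms by blast

lemma sum_over_aggregates:
  fixes g :: "'r::finite + 'c::finite \<Rightarrow> real"
  assumes "every_rod_in_aggregate c \<alpha> \<beta> t"
  shows "sum g UNIV = (\<Sum>S | aggregate c \<alpha> \<beta> t S. sum g S)"
proof -
  have "\<Union>{S. aggregate c \<alpha> \<beta> t S} = UNIV"
    using assms by (auto simp: every_rod_in_aggregate_def)
  then show ?thesis
    using sum.Union_disjoint[of "{S. aggregate c \<alpha> \<beta> t S}" g]
    by (simp add: aggregates_disjoint)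
qed

text \<open>The force on a rod, counted downwards.\<close>

definition load :: "('r \<Rightarrow> real) \<Rightarrow> ('c \<Rightarrow> real) \<Rightarrow> 'r + 'c \<Rightarrow> real" where
  "load a b = case_sum a (\<lambda>j. - b j)"

lemma sum_rods:
  fixes g :: "'r::finite + 'c::finite \<Rightarrow> real"
  shows "sum g S = (\<Sum>i | Inl i \<in> S. g (Inl i)) + (\<Sum>j | Inr j \<in> S. g (Inr j))"
proof -
  have "S = {i. Inl i \<in> S} <+> {j. Inr j \<in> S}"
  proof (rule set_eqI)
    fix p show "p \<in> S \<longleftrightarrow> p \<in> {i. Inl i \<in> S} <+> {j. Inr j \<in> S}"
      by (cases p) auto
  qed
  then have "sum g S = sum g ({i. Inl i \<in> S} <+> {j. Inr j \<in> S})"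
    by (rule arg_cong)
  then show ?thesis by (simp add: sum.Plus)
qed

lemma sum_load: "sum (load a b) S = total_weight a b S"
  by (simp add: sum_rods total_weight_def load_def sum_negf)

section \<open>Potential energy\<close>

definition energy ::
  "('r::finite \<Rightarrow> real) \<Rightarrow> ('c::finite \<Rightarrow> real) \<Rightarrow>
   ('r \<Rightarrow> real \<Rightarrow> real) \<Rightarrow> ('c \<Rightarrow> real \<Rightarrow> real) \<Rightarrow> real \<Rightarrow> real" where
  "energy a b \<alpha> \<beta> t = (\<Sum>p\<in>UNIV. load a b p * height \<alpha> \<beta> p t)"

lemma energy_eq: "energy a b \<alpha> \<beta> t = (\<Sum>i\<in>UNIV. a i * \<alpha> i t) - (\<Sum>j\<in>UNIV. b j * \<beta> j t)"
  by (simp add: energy_def sum_rods load_def height_def sum_negf)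

lemma energy_continuous:
  assumes "motion c a b \<alpha> \<beta>"
  shows "continuous_on {0..} (energy a b \<alpha> \<beta>)"
  unfolding energy_def using assms by (intro continuous_intros) (auto simp: motion_def)

text \<open>
  This is weak duality for the transportation problem: the heights are dual variables, and any
  transportation plan with marginals \<open>a\<close> and \<open>b\<close> yields a lower bound. The product plan
  \<open>a i * b j / A\<close>, where \<open>A\<close> is the common total, is such a plan; if \<open>A = 0\<close> it is the zero plan
  by the convention for division by 0, which then has the right marginals too.
\<close>

lemma energy_bounded_below:
  fixes c :: "'r::finite \<Rightarrow> 'c::finite \<Rightarrow> real"
  assumes a: "\<forall>i. a i \<ge> 0" and b: "\<forall>j. b j \<ge> 0"
    and bal: "(\<Sum>i\<in>UNIV. a i) = (\<Sum>j\<in>UNIV. b j)"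
    and dist: "\<forall>i j. \<alpha> i t - \<beta> j t \<ge> c i j"
  shows "energy a b \<alpha> \<beta> t \<ge> (\<Sum>i\<in>UNIV. \<Sum>j\<in>UNIV. a i * b j / sum a UNIV * c i j)"
proof -
  define A where "A = sum a UNIV"
  define x where "x i j = a i * b j / A" for i j
  have A0: "a i = 0" "b j = 0" if "A = 0" for i j
    using that a b bal sum_nonneg_eq_0_iff[of UNIV a] sum_nonneg_eq_0_iff[of UNIV b]
    by (auto simp: A_def)
  have row: "(\<Sum>j\<in>UNIV. x i j) = a i" for i
    using A0(1)[of i] bal
    by (cases "A = 0") (simp_all add: x_def A_def flip: sum_distrib_left sum_divide_distrib)
  have col: "(\<Sum>i\<in>UNIV. x i j) = b j" for j
    using A0(2)[of j]
    by (cases "A = 0") (simp_all add: x_def A_def flip: sum_distrib_right sum_divide_distrib)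
  have "x i j \<ge> 0" for i j
    using a b by (simp add: x_def A_def sum_nonneg)
  then have "(\<Sum>i\<in>UNIV. \<Sum>j\<in>UNIV. x i j * c i j)
      \<le> (\<Sum>i\<in>UNIV. \<Sum>j\<in>UNIV. x i j * (\<alpha> i t - \<beta> j t))"
    using dist by (intro sum_mono mult_left_mono) auto
  also have "\<dots> = (\<Sum>i\<in>UNIV. \<Sum>j\<in>UNIV. x i j * \<alpha> i t) - (\<Sum>i\<in>UNIV. \<Sum>j\<in>UNIV. x i j * \<beta> j t)"
    by (simp add: right_diff_distrib sum_subtractf)
  also have "(\<Sum>i\<in>UNIV. \<Sum>j\<in>UNIV. x i j * \<beta> j t) = (\<Sum>j\<in>UNIV. \<Sum>i\<in>UNIV. x i j * \<beta> j t)"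
    by (rule sum.swap)
  also have "(\<Sum>i\<in>UNIV. \<Sum>j\<in>UNIV. x i j * \<alpha> i t) - (\<Sum>j\<in>UNIV. \<Sum>i\<in>UNIV. x i j * \<beta> j t)
      = energy a b \<alpha> \<beta> t"
    by (simp add: energy_eq row col flip: sum_distrib_right)
  finally show ?thesis by (simp add: x_def A_def)
qed

section \<open>Dissipation of energy\<close>

lemma law_of_motion_velocity:
  assumes "law_of_motion c a b \<alpha> \<beta> t" "aggregate c \<alpha> \<beta> t S" "p \<in> S"
  shows "(height \<alpha> \<beta> p has_real_derivative - total_weight a b S) (at t)"
  using assms by (auto simp: law_of_motion_def moves_with_def)

lemma energy_dissipation:
  assumes law: "law_of_motion c a b \<alpha> \<beta> t"
  shows "(energy a b \<alpha> \<beta> has_real_derivative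
           - (\<Sum>S | aggregate c \<alpha> \<beta> t S. (total_weight a b S)\<^sup>2)) (at t)"
proof -
  define v where "v p = deriv (height \<alpha> \<beta> p) t" for p
  have every: "every_rod_in_aggregate c \<alpha> \<beta> t"
    using law by (simp add: law_of_motion_def)
  have v: "v p = - total_weight a b S" if "aggregate c \<alpha> \<beta> t S" "p \<in> S" for p S
    unfolding v_def using law_of_motion_velocity[OF law that] by (rule DERIV_imp_deriv)
  have "(height \<alpha> \<beta> p has_real_derivative v p) (at t)" for p
    using every law_of_motion_velocity[OF law] v by (metis every_rod_in_aggregate_def)
  then have "(energy a b \<alpha> \<beta> has_real_derivative (\<Sum>p\<in>UNIV. load a b p * v p)) (at t)"
    unfolding energy_def by (intro DERIV_sum DERIV_cmult)
  also have "(\<Sum>p\<in>UNIV. load a b p * v p)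
      = (\<Sum>S | aggregate c \<alpha> \<beta> t S. \<Sum>p\<in>S. load a b p * v p)"
    using every by (rule sum_over_aggregates)
  also have "\<dots> = (\<Sum>S | aggregate c \<alpha> \<beta> t S. - (total_weight a b S)\<^sup>2)"
  proof (rule sum.cong)
    fix S assume "S \<in> {S. aggregate c \<alpha> \<beta> t S}"
    then have "(\<Sum>p\<in>S. load a b p * v p) = (\<Sum>p\<in>S. load a b p * - total_weight a b S)"
      by (intro sum.cong) (auto simp: v)
    also have "\<dots> = - (total_weight a b S)\<^sup>2"
      by (simp add: sum_load power2_eq_square sum_negf flip: sum_distrib_right)
    finally show "(\<Sum>p\<in>S. load a b p * v p) = - (total_weight a b S)\<^sup>2" .
  qed simp
  finally show ?thesis by (simp add: sum_negf)
qed

definition rests ::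
  "('r::finite \<Rightarrow> 'c::finite \<Rightarrow> real) \<Rightarrow> ('r \<Rightarrow> real) \<Rightarrow> ('c \<Rightarrow> real) \<Rightarrow>
   ('r \<Rightarrow> real \<Rightarrow> real) \<Rightarrow> ('c \<Rightarrow> real \<Rightarrow> real) \<Rightarrow> real \<Rightarrow> bool" where
  "rests c a b \<alpha> \<beta> t \<longleftrightarrow>
     law_of_motion c a b \<alpha> \<beta> t \<and> (\<forall>S. aggregate c \<alpha> \<beta> t S \<longrightarrow> total_weight a b S = 0)"

lemma rests_velocity:
  assumes "rests c a b \<alpha> \<beta> t"
  shows "(height \<alpha> \<beta> p has_real_derivative 0) (at t)"
proof -
  obtain S where S: "aggregate c \<alpha> \<beta> t S" "p \<in> S"
    using assms unfolding rests_def law_of_motion_def every_rod_in_aggregate_def by blast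
  with assms show ?thesis
    using law_of_motion_velocity[of c a b \<alpha> \<beta> t S p] by (simp add: rests_def)
qed

lemma rests_if_no_dissipation:
  assumes law: "law_of_motion c a b \<alpha> \<beta> t"
    and "(energy a b \<alpha> \<beta> has_real_derivative 0) (at t)"
  shows "rests c a b \<alpha> \<beta> t"
proof -
  have "(\<Sum>S | aggregate c \<alpha> \<beta> t S. (total_weight a b S)\<^sup>2) = 0"
    using DERIV_unique[OF energy_dissipation[OF law] assms(2)] by simp
  then show ?thesis
    using law by (simp add: rests_def sum_nonneg_eq_0_iff)
qed

text \<open>The 1 only keeps the set nonempty when all sets of rods have weight 0.\<close>

definition weight_gap :: "('r::finite \<Rightarrow> real) \<Rightarrow> ('c::finite \<Rightarrow> real) \<Rightarrow> real" where
  "weight_gap a b = Min (insert 1 {(total_weight a b S)\<^sup>2 | S. total_weight a b S \<noteq> 0})"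

lemma weight_gap_pos: "weight_gap a b > 0"
  unfolding weight_gap_def by (subst Min_gr_iff) auto

lemma weight_gap_le: "total_weight a b S \<noteq> 0 \<Longrightarrow> weight_gap a b \<le> (total_weight a b S)\<^sup>2"
  unfolding weight_gap_def by (rule Min_le) auto

lemma dissipation_ge_weight_gap:
  assumes "law_of_motion c a b \<alpha> \<beta> t" and "\<not> rests c a b \<alpha> \<beta> t"
  shows "weight_gap a b \<le> (\<Sum>S | aggregate c \<alpha> \<beta> t S. (total_weight a b S)\<^sup>2)"
proof -
  obtain S where S: "aggregate c \<alpha> \<beta> t S" "total_weight a b S \<noteq> 0"
    using assms by (auto simp: rests_def)
  then have "weight_gap a b \<le> (total_weight a b S)\<^sup>2" by (simp add: weight_gap_le)
  also have "\<dots> \<le> (\<Sum>S | aggregate c \<alpha> \<beta> t S. (total_weight a b S)\<^sup>2)"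
    using S by (intro member_le_sum) auto
  finally show ?thesis .
qed

lemma energy_nonincreasing:
  assumes mot: "motion c a b \<alpha> \<beta>" and "0 \<le> s" "s \<le> t"
  shows "energy a b \<alpha> \<beta> t \<le> energy a b \<alpha> \<beta> s"
proof (rule nonincreasing_if_decreasing_at_right[OF _ _ \<open>s \<le> t\<close>])
  show "continuous_on {s..} (energy a b \<alpha> \<beta>)"
    using energy_continuous[OF mot] by (rule continuous_on_subset) (use \<open>0 \<le> s\<close> in auto)
  fix u assume "u \<ge> s"
  with mot \<open>0 \<le> s\<close> have "\<forall>\<^sub>F x in at_right u. law_of_motion c a b \<alpha> \<beta> x"
    by (simp add: motion_def)
  then show "\<forall>\<^sub>F x in at_right u. \<exists>y. (energy a b \<alpha> \<beta> has_real_derivative y) (at x) \<and> y \<le> 0"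
  proof (rule eventually_mono)
    fix x assume "law_of_motion c a b \<alpha> \<beta> x"
    then show "\<exists>y. (energy a b \<alpha> \<beta> has_real_derivative y) (at x) \<and> y \<le> 0"
      by (intro exI conjI, rule energy_dissipation) (simp add: sum_nonneg)
  qed
qed

section \<open>Instants of rest\<close>

text \<open>
  In an aggregate every contact fixes a difference of heights, so two positions with the same
  contacts differ on it by a translation; this does not affect the energy of an aggregate of
  weight 0.
\<close>

lemma energy_at_rest_determined_by_contacts:
  assumes s: "rests c a b \<alpha> \<beta> s" and G: "contacts c \<alpha> \<beta> s = contacts c \<alpha> \<beta> t"
  shows "energy a b \<alpha> \<beta> s = energy a b \<alpha> \<beta> t"
proof -
  define d where "d p = height \<alpha> \<beta> p s - height \<alpha> \<beta> p t" for p
  have contact: "d p = d q" if "(p, q) \<in> contacts c \<alpha> \<beta> s" for p q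
  proof -
    have "(p, q) \<in> contacts c \<alpha> \<beta> t" using that G by simp
    with that show ?thesis by (auto simp: contacts_def d_def height_def)
  qed
  have translation: "d q = d p" if S: "aggregate c \<alpha> \<beta> s S" and "p \<in> S" "q \<in> S" for S p q
  proof -
    have "(p, q) \<in> (contacts c \<alpha> \<beta> s \<inter> S \<times> S)\<^sup>*"
      using that by (simp add: aggregate_def connected_rods_def)
    then show ?thesis
      by induction (use contact in auto)
  qed
  have "energy a b \<alpha> \<beta> s - energy a b \<alpha> \<beta> t = (\<Sum>p\<in>UNIV. load a b p * d p)"
    by (simp add: energy_def d_def right_diff_distrib sum_subtractf)
  also have "\<dots> = (\<Sum>S | aggregate c \<alpha> \<beta> s S. \<Sum>p\<in>S. load a b p * d p)"
    using s by (intro sum_over_aggregates) (simp add: rests_def law_of_motion_def)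
  also have "\<dots> = 0"
  proof (rule sum.neutral, rule ballI)
    fix S assume "S \<in> {S. aggregate c \<alpha> \<beta> s S}"
    then have S: "aggregate c \<alpha> \<beta> s S" by simp
    then obtain p where "p \<in> S"
      by (auto simp: aggregate_def connected_rods_def)
    have "(\<Sum>q\<in>S. load a b q * d q) = (\<Sum>q\<in>S. load a b q * d p)"
    proof (rule sum.cong)
      fix q assume "q \<in> S"
      with S \<open>p \<in> S\<close> have "d q = d p" by (rule translation)
      then show "load a b q * d q = load a b q * d p" by (rule arg_cong)
    qed simp
    also have "\<dots> = total_weight a b S * d p"
      by (simp add: sum_load flip: sum_distrib_right)
    finally show "(\<Sum>q\<in>S. load a b q * d q) = 0"
      using s S by (simp add: rests_def)
  qed
  finally show ?thesis by simp
qed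

lemma finite_energy_at_rest:
  fixes c :: "'r::finite \<Rightarrow> 'c::finite \<Rightarrow> real"
  shows "finite (energy a b \<alpha> \<beta> ` {t. rests c a b \<alpha> \<beta> t})"
proof -
  define R where "R = {t. rests c a b \<alpha> \<beta> t}"
  define pick where "pick G = (SOME t. t \<in> R \<and> contacts c \<alpha> \<beta> t = G)" for G
  have "energy a b \<alpha> \<beta> t = energy a b \<alpha> \<beta> (pick (contacts c \<alpha> \<beta> t))" if "t \<in> R" for t
  proof -
    have "pick (contacts c \<alpha> \<beta> t) \<in> R
        \<and> contacts c \<alpha> \<beta> (pick (contacts c \<alpha> \<beta> t)) = contacts c \<alpha> \<beta> t"
      unfolding pick_def by (rule someI[of _ t]) (use that in simp)
    then have "contacts c \<alpha> \<beta> t = contacts c \<alpha> \<beta> (pick (contacts c \<alpha> \<beta> t))" by simp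
    with that show ?thesis
      unfolding R_def by (intro energy_at_rest_determined_by_contacts) auto
  qed
  then have "energy a b \<alpha> \<beta> ` R \<subseteq> (\<lambda>G. energy a b \<alpha> \<beta> (pick G)) ` UNIV"
    by auto
  then show ?thesis
    unfolding R_def[symmetric] by (rule finite_subset) simp
qed

lemma rest_times_unbounded:
  fixes c :: "'r::finite \<Rightarrow> 'c::finite \<Rightarrow> real"
  assumes a: "\<forall>i. a i \<ge> 0" and b: "\<forall>j. b j \<ge> 0"
    and bal: "(\<Sum>i\<in>UNIV. a i) = (\<Sum>j\<in>UNIV. b j)"
    and mot: "motion c a b \<alpha> \<beta>" and "T \<ge> 0"
  shows "\<exists>t\<ge>T. rests c a b \<alpha> \<beta> t"
proof (rule ccontr)
  assume "\<not> (\<exists>t\<ge>T. rests c a b \<alpha> \<beta> t)"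
  then have moving: "\<not> rests c a b \<alpha> \<beta> t" if "t \<ge> T" for t
    using that by auto
  define k where "k = weight_gap a b"
  have "k > 0" by (simp add: k_def weight_gap_pos)
  have decay: "energy a b \<alpha> \<beta> t + k * t \<le> energy a b \<alpha> \<beta> T + k * T" if "t \<ge> T" for t
  proof (rule nonincreasing_if_decreasing_at_right[OF _ _ that])
    show "continuous_on {T..} (\<lambda>t. energy a b \<alpha> \<beta> t + k * t)"
      using continuous_on_subset[OF energy_continuous[OF mot], of "{T..}"] \<open>T \<ge> 0\<close>
      by (intro continuous_intros) auto
    fix u assume "u \<ge> T"
    with mot \<open>T \<ge> 0\<close> have "\<forall>\<^sub>F x in at_right u. law_of_motion c a b \<alpha> \<beta> x"
      by (simp add: motion_def)
    then show "\<forall>\<^sub>F x in at_right u.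
        \<exists>y. ((\<lambda>t. energy a b \<alpha> \<beta> t + k * t) has_real_derivative y) (at x) \<and> y \<le> 0"
      using eventually_at_right_less[of u]
    proof eventually_elim
      fix x assume law: "law_of_motion c a b \<alpha> \<beta> x" and "u < x"
      let ?D = "\<Sum>S | aggregate c \<alpha> \<beta> x S. (total_weight a b S)\<^sup>2"
      have "((\<lambda>t. energy a b \<alpha> \<beta> t + k * t) has_real_derivative - ?D + k * 1) (at x)"
        by (intro DERIV_add energy_dissipation[OF law] DERIV_cmult DERIV_ident)
      moreover have "- ?D + k * 1 \<le> 0"
        using dissipation_ge_weight_gap[OF law moving] \<open>u < x\<close> \<open>u \<ge> T\<close> by (simp add: k_def)
      ultimately show
        "\<exists>y. ((\<lambda>t. energy a b \<alpha> \<beta> t + k * t) has_real_derivative y) (at x) \<and> y \<le> 0"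
        by blast
    qed
  qed
  define L where "L = (\<Sum>i\<in>UNIV. \<Sum>j\<in>UNIV. a i * b j / sum a UNIV * c i j)"
  have low: "energy a b \<alpha> \<beta> t \<ge> L" if "t \<ge> 0" for t
    unfolding L_def using a b bal
    by (rule energy_bounded_below) (use mot that in \<open>auto simp: motion_def\<close>)
  \<comment> \<open>At rate \<open>k\<close> the energy above \<open>L\<close> is used up one unit of time before \<open>t\<close>.\<close>
  define t where "t = T + (energy a b \<alpha> \<beta> T - L) / k + 1"
  have "t \<ge> T"
    using low[OF \<open>T \<ge> 0\<close>] \<open>k > 0\<close> by (simp add: t_def)
  moreover have "k * t = k * T + (energy a b \<alpha> \<beta> T - L) + k"
    using \<open>k > 0\<close> by (simp add: t_def distrib_left)
  ultimately show False
    using decay[of t] low[of t] \<open>T \<ge> 0\<close> \<open>k > 0\<close> by simp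
qed

lemma energy_eventually_constant:
  fixes c :: "'r::finite \<Rightarrow> 'c::finite \<Rightarrow> real"
  assumes a: "\<forall>i. a i \<ge> 0" and b: "\<forall>j. b j \<ge> 0"
    and bal: "(\<Sum>i\<in>UNIV. a i) = (\<Sum>j\<in>UNIV. b j)"
    and mot: "motion c a b \<alpha> \<beta>"
  shows "\<exists>T\<ge>0. \<forall>t\<ge>T. energy a b \<alpha> \<beta> t = energy a b \<alpha> \<beta> T"
proof -
  let ?U = "energy a b \<alpha> \<beta>"
  define R where "R = {t. t \<ge> 0 \<and> rests c a b \<alpha> \<beta> t}"
  have unbounded: "\<exists>t\<in>R. t \<ge> T" if "T \<ge> 0" for T
  proof -
    from rest_times_unbounded[OF a b bal mot that]
    obtain t where "t \<ge> T" "rests c a b \<alpha> \<beta> t" by blast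
    with \<open>T \<ge> 0\<close> show ?thesis by (intro bexI[of _ t]) (auto simp: R_def)
  qed
  have "finite (?U ` R)"
    using finite_energy_at_rest[of a b \<alpha> \<beta> c] by (rule finite_subset[rotated]) (auto simp: R_def)
  moreover have "R \<noteq> {}" using unbounded[of 0] by auto
  ultimately have "Min (?U ` R) \<in> ?U ` R" by simp
  then obtain T where T: "T \<in> R" and min: "?U T = Min (?U ` R)" by force
  have least: "?U T \<le> ?U s" if "s \<in> R" for s
    unfolding min using \<open>finite (?U ` R)\<close> that by (intro Min_le) auto
  have "?U t = ?U T" if "t \<ge> T" for t
  proof -
    have "T \<ge> 0" using T by (simp add: R_def)
    then obtain s where s: "s \<in> R" "s \<ge> t" using unbounded[of t] \<open>t \<ge> T\<close> by auto
    have "?U T \<le> ?U s" by (rule least) fact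
    also have "\<dots> \<le> ?U t"
      using s \<open>T \<ge> 0\<close> \<open>t \<ge> T\<close> by (intro energy_nonincreasing[OF mot]) auto
    finally show ?thesis
      using energy_nonincreasing[OF mot \<open>T \<ge> 0\<close> \<open>t \<ge> T\<close>] by simp
  qed
  with T show ?thesis by (auto simp: R_def)
qed

lemma heights_eventually_constant:
  fixes c :: "'r::finite \<Rightarrow> 'c::finite \<Rightarrow> real"
  assumes mot: "motion c a b \<alpha> \<beta>" and "T \<ge> 0"
    and const: "\<And>t. t \<ge> T \<Longrightarrow> energy a b \<alpha> \<beta> t = energy a b \<alpha> \<beta> T" and "t \<ge> T"
  shows "height \<alpha> \<beta> p t = height \<alpha> \<beta> p T"
proof -
  have vel: "\<forall>\<^sub>F x in at_right u. (height \<alpha> \<beta> p has_real_derivative 0) (at x)" if "u \<ge> T" for u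
  proof -
    have "\<forall>\<^sub>F x in at_right u. law_of_motion c a b \<alpha> \<beta> x"
      using mot \<open>T \<ge> 0\<close> that by (simp add: motion_def)
    then show ?thesis
      using eventually_at_right_less[of u]
    proof eventually_elim
      fix x assume law: "law_of_motion c a b \<alpha> \<beta> x" and "u < x"
      have "(energy a b \<alpha> \<beta> has_real_derivative 0) (at x)"
      proof (rule derivative_zero_if_constant[where T = T])
        show "x > T" using \<open>u < x\<close> \<open>u \<ge> T\<close> by simp
      qed (rule const)
      then show "(height \<alpha> \<beta> p has_real_derivative 0) (at x)"
        by (intro rests_velocity[OF rests_if_no_dissipation[OF law]])
    qed
  qed
  have cont: "continuous_on {T..} (height \<alpha> \<beta> p)"
    by (rule continuous_on_subset[of "{0..}"]) (use mot \<open>T \<ge> 0\<close> in \<open>auto simp: motion_def\<close>)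
  have "height \<alpha> \<beta> p t \<le> height \<alpha> \<beta> p T"
  proof (rule nonincreasing_if_decreasing_at_right[OF cont _ \<open>t \<ge> T\<close>])
    fix u assume "u \<ge> T"
    from vel[OF this] show
      "\<forall>\<^sub>F x in at_right u. \<exists>y. (height \<alpha> \<beta> p has_real_derivative y) (at x) \<and> y \<le> 0"
      by (rule eventually_mono) auto
  qed
  moreover have "- height \<alpha> \<beta> p t \<le> - height \<alpha> \<beta> p T"
  proof (rule nonincreasing_if_decreasing_at_right[where f = "\<lambda>x. - height \<alpha> \<beta> p x", OF _ _ \<open>t \<ge> T\<close>])
    show "continuous_on {T..} (\<lambda>x. - height \<alpha> \<beta> p x)"
      using cont by (intro continuous_intros)
    fix u assume "u \<ge> T"
    from vel[OF this] show
      "\<forall>\<^sub>F x in at_right u. \<exists>y. ((\<lambda>x. - height \<alpha> \<beta> p x) has_real_derivative y) (at x) \<and> y \<le> 0"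
    proof (rule eventually_mono)
      fix x assume "(height \<alpha> \<beta> p has_real_derivative 0) (at x)"
      from DERIV_minus[OF this]
      show "\<exists>y. ((\<lambda>x. - height \<alpha> \<beta> p x) has_real_derivative y) (at x) \<and> y \<le> 0"
        by (intro exI[of _ 0]) simp
    qed
  qed
  ultimately show ?thesis by simp
qed

section \<open>Equilibrium\<close>

text \<open>
  Constant heights give velocity 0 at once. That the rods are covered by aggregates
  at \<open>t\<close> is read off from a nearby later instant at which the law of motion holds, since the
  contacts are the same there. Derivatives are two-sided, whence the strict inequality.
\<close>

lemma equilibrium_if_heights_constant:
  fixes c :: "'r::finite \<Rightarrow> 'c::finite \<Rightarrow> real"
  assumes mot: "motion c a b \<alpha> \<beta>" and "T \<ge> 0"
    and const: "\<And>t p. t \<ge> T \<Longrightarrow> height \<alpha> \<beta> p t = height \<alpha> \<beta> p T" and "t > T"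
  shows "equilibrium c \<alpha> \<beta> t"
proof -
  have "(height \<alpha> \<beta> p has_real_derivative 0) (at t)" for p
    using const \<open>t > T\<close> by (rule derivative_zero_if_constant)
  then have still: "moves_with \<alpha> \<beta> t S 0" for S
    by (simp add: moves_with_def)
  have "\<forall>\<^sub>F s in at_right t. law_of_motion c a b \<alpha> \<beta> s \<and> t < s"
    using mot \<open>T \<ge> 0\<close> \<open>t > T\<close> by (auto simp: motion_def eventually_at_right_less intro: eventually_conj)
  then obtain s where law: "law_of_motion c a b \<alpha> \<beta> s" and "t < s"
    using eventually_happens'[OF trivial_limit_at_right_real] by blast
  have "height \<alpha> \<beta> p s = height \<alpha> \<beta> p t" for p
    using const[of s p] const[of t p] \<open>t < s\<close> \<open>t > T\<close> by simp
  from this[of "Inl _"] this[of "Inr _"]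
  have "contacts c \<alpha> \<beta> s = contacts c \<alpha> \<beta> t"
    by (simp add: contacts_def height_def)
  then have "aggregate c \<alpha> \<beta> t S" if "aggregate c \<alpha> \<beta> s S" for S
    using that still by (auto simp: aggregate_def)
  then have "every_rod_in_aggregate c \<alpha> \<beta> t"
    using law by (force simp: law_of_motion_def every_rod_in_aggregate_def)
  with still show ?thesis by (simp add: equilibrium_def)
qed

theorem theorem1:
  fixes c :: "'r::finite \<Rightarrow> 'c::finite \<Rightarrow> real"
    and a :: "'r \<Rightarrow> real" and b :: "'c \<Rightarrow> real"
    and \<alpha> :: "'r \<Rightarrow> real \<Rightarrow> real" and \<beta> :: "'c \<Rightarrow> real \<Rightarrow> real"
  assumes "\<forall>i. a i \<ge> 0" and "\<forall>j. b j \<ge> 0"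
    and "(\<Sum>i\<in>UNIV. a i) = (\<Sum>j\<in>UNIV. b j)"
    and "initial_position c \<alpha> \<beta>"
    and "motion c a b \<alpha> \<beta>"
  shows "\<exists>T\<ge>0. \<forall>t\<ge>T. equilibrium c \<alpha> \<beta> t"
proof -
  obtain T where "T \<ge> 0" and U: "\<And>t. t \<ge> T \<Longrightarrow> energy a b \<alpha> \<beta> t = energy a b \<alpha> \<beta> T"
    using energy_eventually_constant[OF assms(1-3,5)] by blast
  have "equilibrium c \<alpha> \<beta> t" if "t \<ge> T + 1" for t
  proof (rule equilibrium_if_heights_constant[OF assms(5) \<open>T \<ge> 0\<close>])
    show "height \<alpha> \<beta> p s = height \<alpha> \<beta> p T" if "s \<ge> T" for s p
      using assms(5) \<open>T \<ge> 0\<close> U that by (rule heights_eventually_constant)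
    show "T < t" using that by simp
  qed
  then show ?thesis
    using \<open>T \<ge> 0\<close> by (intro exI[of _ "T + 1"]) simp
qed

end
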